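(* Let $(\mathcal{A},\bullet,\omega)$ be a pre-symplectic left-symmetric algebra over $\mathbb{K}$ such that $[\mathcal{A},\mathcal{A}]$ is nondegenerate with respect to $\omega$. Then the Lie algebra $\mathcal{A}^-$ is nilpotent if and only if the product $\bullet$ is trivial (identically zero).
   Context: $\mathbb{K}$ is a field of characteristic $0$; all vector spaces are finite-dimensional. For an algebra $(\mathcal{A},\bullet)$: $[u,v]_\bullet=u\bullet v-v\bullet u$, $\mathcal{A}^-$ is $\mathcal{A}$ with this bracket, $[\mathcal{A},\mathcal{A}]=\mathrm{span}\{[u,v]_\bullet\}$. With $(u,v,w)=(u\bullet v)\bullet w-u\bullet(v\bullet w)$, the algebra is left-symmetric if $(u,v,w)=(v,u,w)$ for all $u,v,w$ (then $\mathcal{A}^-$ is a Lie algebra). A pre-symplectic left-symmetric algebra is a triple $(\mathcal{A},\bullet,\omega)$ with $(\mathcal{A},\bullet)$ left-symmetric and $\omega$ a nondegenerate skew-symmetric bilinear form such that $\omega(u\bullet v,w)=\omega(v,u\bullet w)$ for all $u,v,w$. A subspace $F$ is nondegenerate if $F\cap F^\perp=\{0\}$, where $F^\perp=\{x:\omega(x,y)=0\ \forall y\in F\}$. *)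

theory Defs
  imports Complex_Main
begin

locale algebra_over = vector_space scale
  for scale :: "'k::field \<Rightarrow> 'v::ab_group_add \<Rightarrow> 'v" +
  fixes mult :: "'v \<Rightarrow> 'v \<Rightarrow> 'v"
  assumes linear_mult_left: "Vector_Spaces.linear scale scale (\<lambda>u. mult u v)"
    and linear_mult_right: "Vector_Spaces.linear scale scale (mult u)"

definition associator :: "('v \<Rightarrow> 'v \<Rightarrow> 'v) \<Rightarrow> 'v \<Rightarrow> 'v \<Rightarrow> 'v \<Rightarrow> 'v::ab_group_add" where
  "associator mult u v w = mult (mult u v) w - mult u (mult v w)"

definition commutator :: "('v \<Rightarrow> 'v \<Rightarrow> 'v) \<Rightarrow> 'v \<Rightarrow> 'v \<Rightarrow> 'v::ab_group_add" where
  "commutator mult u v = mult u v - mult v u"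

locale left_symmetric_algebra = algebra_over scale mult
  for scale :: "'k::field \<Rightarrow> 'v::ab_group_add \<Rightarrow> 'v" and mult +
  assumes left_symmetric: "associator mult u v w = associator mult v u w"

locale lie_algebra = algebra_over scale bracket
  for scale :: "'k::field \<Rightarrow> 'v::ab_group_add \<Rightarrow> 'v" and bracket +
  assumes alternating: "bracket x x = 0"
    and jacobi: "bracket x (bracket y z) + bracket y (bracket z x) + bracket z (bracket x y) = 0"

definition bracket_span ::
    "('k::field \<Rightarrow> 'v::ab_group_add \<Rightarrow> 'v) \<Rightarrow> ('v \<Rightarrow> 'v \<Rightarrow> 'v) \<Rightarrow> 'v set \<Rightarrow> 'v set \<Rightarrow> 'v set" where
  "bracket_span scale bracket S T = module.span scale {bracket u v | u v. u \<in> S \<and> v \<in> T}"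

(* Index 0 is the whole algebra, index 1 the derived algebra. *)
primrec lower_central_series ::
    "('k::field \<Rightarrow> 'v::ab_group_add \<Rightarrow> 'v) \<Rightarrow> ('v \<Rightarrow> 'v \<Rightarrow> 'v) \<Rightarrow> nat \<Rightarrow> 'v set" where
  "lower_central_series scale bracket 0 = UNIV"
| "lower_central_series scale bracket (Suc n) =
     bracket_span scale bracket UNIV (lower_central_series scale bracket n)"

definition nilpotent_bracket ::
    "('k::field \<Rightarrow> 'v::ab_group_add \<Rightarrow> 'v) \<Rightarrow> ('v \<Rightarrow> 'v \<Rightarrow> 'v) \<Rightarrow> bool" where
  "nilpotent_bracket scale bracket \<longleftrightarrow> (\<exists>n. lower_central_series scale bracket n = {0})"

definition orthogonal_space :: "('v \<Rightarrow> 'v \<Rightarrow> 'k::zero) \<Rightarrow> 'v set \<Rightarrow> 'v set" where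
  "orthogonal_space \<omega> F = {x. \<forall>y\<in>F. \<omega> x y = 0}"

definition nondegenerate_on :: "('v::zero \<Rightarrow> 'v \<Rightarrow> 'k::zero) \<Rightarrow> 'v set \<Rightarrow> bool" where
  "nondegenerate_on \<omega> F \<longleftrightarrow> F \<inter> orthogonal_space \<omega> F = {0}"

(* Basis is only a witness of finite dimensionality: no condition refers to it. *)
locale pre_symplectic_left_symmetric_algebra =
  finite_dimensional_vector_space scale Basis + left_symmetric_algebra scale mult
  for scale :: "'k::field_char_0 \<Rightarrow> 'v::ab_group_add \<Rightarrow> 'v" and Basis and mult +
  fixes \<omega> :: "'v \<Rightarrow> 'v \<Rightarrow> 'k"
  assumes linear_form_left: "Vector_Spaces.linear scale (*) (\<lambda>u. \<omega> u v)"
    and linear_form_right: "Vector_Spaces.linear scale (*) (\<omega> u)"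
    and skew_symmetric: "\<omega> u v = - \<omega> v u"
    and nondegenerate: "nondegenerate_on \<omega> UNIV"
    and form_mult: "\<omega> (mult u v) w = \<omega> v (mult u w)"

context left_symmetric_algebra
begin

lemma mult_diff_left: "mult (a - b) c = mult a c - mult b c"
  using module_hom.diff[OF linear_mult_left[unfolded linear_iff_module_hom]] .

lemma mult_diff_right: "mult c (a - b) = mult c a - mult c b"
  using module_hom.diff[OF linear_mult_right[unfolded linear_iff_module_hom]] .

lemma lie_algebra_commutator: "lie_algebra scale (commutator mult)"
proof (intro lie_algebra.intro algebra_over.intro algebra_over_axioms.intro lie_algebra_axioms.intro)
  fix x y z
  have "commutator mult x (commutator mult y z) + commutator mult y (commutator mult z x)
      + commutator mult z (commutator mult x y)
      = (associator mult y x z - associator mult x y z) + (associator mult z y x - associator mult y z x)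
      + (associator mult x z y - associator mult z x y)"
    by (simp add: commutator_def associator_def mult_diff_left mult_diff_right algebra_simps)
  then show "commutator mult x (commutator mult y z) + commutator mult y (commutator mult z x)
      + commutator mult z (commutator mult x y) = 0"
    using left_symmetric[of x y z] left_symmetric[of y z x] left_symmetric[of z x y] by simp
next
  show "vector_space scale" by (rule vector_space_axioms)
  show "Vector_Spaces.linear scale scale (\<lambda>u. commutator mult u v)" for v
    using linear_mult_left[of v] linear_mult_right[of v]
    by (simp add: commutator_def linear_iff_module_hom module_hom_iff algebra_simps)
  show "Vector_Spaces.linear scale scale (commutator mult u)" for u
    using linear_mult_left[of u] linear_mult_right[of u]
    by (simp add: commutator_def linear_iff_module_hom module_hom_iff algebra_simps)
  show "commutator mult x x = 0" for x
    by (simp add: commutator_def)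
qed

end

end

theory Submission
  imports Defs
begin

text \<open>
  Write \<open>L u\<close> for left multiplication by \<open>u\<close> and \<open>D\<close> for \<open>[A, A]\<close>. Left symmetry says
  \<open>L [u, v] = [L u, L v]\<close>. Every \<open>L u\<close> is self-adjoint for \<open>\<omega>\<close>, while a commutator of
  self-adjoint operators is anti-self-adjoint; so \<open>L [u, v]\<close> is both, hence zero. Therefore
  \<open>D\<close> annihilates the algebra from the left, and on \<open>D\<close> the operators \<open>ad u\<close> and \<open>L u\<close> agree,
  so that \<open>ad u\<close> is self-adjoint there.

  This makes the lower central series orthogonally large: by induction, no nonzero vector of
  \<open>D\<close> is orthogonal to a term of the series. Indeed, if \<open>x\<close> in \<open>D\<close> is orthogonal to the bracket
  of the algebra with a term \<open>C\<close> inside \<open>D\<close>, then all \<open>L u x\<close> are orthogonal to \<open>C\<close>, hence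
  vanish, and then \<open>\<omega> x [u, v] = \<omega> (L u x) v - \<omega> (L v x) u = 0\<close>, so that \<open>x\<close> is orthogonal to
  \<open>D\<close> itself and \<open>x = 0\<close> by nondegeneracy of \<open>D\<close>. If the series reaches zero, this forces
  \<open>D = 0\<close>, so the product is commutative. For a commutative product, permuting the arguments
  of \<open>\<omega> (u v) w\<close> by self-adjointness returns its negative, and the product vanishes.
\<close>

context algebra_over
begin

lemma mult_zero_left: "mult 0 v = 0"
  using module_hom.zero[OF linear_mult_left[unfolded linear_iff_module_hom]] .

lemma subspace_left_annihilators: "subspace {a. mult a v = 0}"
  using linear_mult_left[of v]
  by (intro subspaceI) (simp_all add: linear_iff_module_hom module_hom_iff mult_zero_left)

lemma bracket_in_bracket_span:
  assumes "u \<in> S" "v \<in> T"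
  shows "mult u v \<in> bracket_span scale mult S T"
  unfolding bracket_span_def using assms by (blast intro: span_base)

lemma lower_central_series_Suc_subset:
  "lower_central_series scale mult (Suc n) \<subseteq> bracket_span scale mult UNIV UNIV"
  unfolding lower_central_series.simps bracket_span_def by (rule span_mono) auto

lemma trivial_bracket_nilpotent:
  assumes "\<And>u v. mult u v = 0"
  shows "nilpotent_bracket scale mult"
proof -
  have "lower_central_series scale mult 1 = {0}"
    using assms by (simp add: bracket_span_def span_zero)
  then show ?thesis
    unfolding nilpotent_bracket_def by blast
qed

end

lemma (in left_symmetric_algebra) mult_commutator_left:
  "mult (commutator mult u v) w = mult u (mult v w) - mult v (mult u w)"
  using left_symmetric[of u v w]
  by (simp add: commutator_def associator_def mult_diff_left algebra_simps)

context pre_symplectic_left_symmetric_algebra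
begin

sublocale minus: lie_algebra scale "commutator mult"
  by (rule lie_algebra_commutator)

abbreviation derived_algebra :: "'v set" where
  "derived_algebra \<equiv> bracket_span scale (commutator mult) UNIV UNIV"

lemma form_diff_left: "\<omega> (a - b) c = \<omega> a c - \<omega> b c"
  using module_hom.diff[OF linear_form_left[unfolded linear_iff_module_hom]] .

lemma form_diff_right: "\<omega> c (a - b) = \<omega> c a - \<omega> c b"
  using module_hom.diff[OF linear_form_right[unfolded linear_iff_module_hom]] .

lemma form_zero_left: "\<omega> 0 w = 0"
  using module_hom.zero[OF linear_form_left[unfolded linear_iff_module_hom]] .

lemma subspace_right_orthogonal: "subspace {y. \<omega> x y = 0}"
  using linear_form_right[of x] module_hom.zero[OF linear_form_right[unfolded linear_iff_module_hom]]
  by (intro subspaceI) (simp_all add: linear_iff_module_hom module_hom_iff)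

lemma eq_zero_if_form_zero:
  assumes "\<And>w. \<omega> x w = 0"
  shows "x = 0"
  using nondegenerate assms unfolding nondegenerate_on_def orthogonal_space_def by blast

text \<open>Left multiplication by a commutator is self-adjoint, like every left multiplication, and
  anti-self-adjoint, being a commutator of self-adjoint operators.\<close>

lemma commutator_mult_eq_zero: "mult (commutator mult u v) w = 0"
proof (rule eq_zero_if_form_zero)
  fix z
  have "\<omega> (mult (commutator mult u v) w) z = - \<omega> w (mult (commutator mult u v) z)"
    by (simp add: mult_commutator_left form_diff_left form_diff_right form_mult)
  also have "\<dots> = - \<omega> (mult (commutator mult u v) w) z"
    by (simp add: form_mult)
  finally show "\<omega> (mult (commutator mult u v) w) z = 0"
    by simp
qed

lemma derived_mult_eq_zero:
  assumes "d \<in> derived_algebra"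
  shows "mult d w = 0"
proof -
  have "derived_algebra \<subseteq> {a. mult a w = 0}"
    unfolding bracket_span_def
    by (rule span_minimal) (auto simp: commutator_mult_eq_zero subspace_left_annihilators)
  with assms show ?thesis by blast
qed

lemma commutator_derived:
  assumes "d \<in> derived_algebra"
  shows "commutator mult u d = mult u d"
  using derived_mult_eq_zero[OF assms] by (simp add: commutator_def)

lemma mult_derived_in_derived:
  assumes "d \<in> derived_algebra"
  shows "mult u d \<in> derived_algebra"
  using minus.bracket_in_bracket_span[of u UNIV d UNIV] commutator_derived[OF assms] by simp

text \<open>The form pairs \<open>x\<close> with a commutator through the left multiples of \<open>x\<close> only.\<close>

lemma orthogonal_derived_if_mult_zero:
  assumes "\<And>u. mult u x = 0" and "y \<in> derived_algebra"
  shows "\<omega> x y = 0"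
proof -
  have "\<omega> x (commutator mult u v) = 0" for u v
    using assms(1) by (simp add: commutator_def form_diff_right form_mult[symmetric] form_zero_left)
  then have "derived_algebra \<subseteq> {y. \<omega> x y = 0}"
    unfolding bracket_span_def
    by (intro span_minimal) (auto simp: subspace_right_orthogonal)
  with assms(2) show ?thesis by blast
qed

text \<open>Self-adjointness of left multiplication moves orthogonality one step up the series: if
  \<open>x\<close> is orthogonal to a term, its left multiples are orthogonal to the preceding one,
  so they vanish by induction.
  The series starts at its term \<open>Suc 0\<close> because the step uses \<open>[u, c] = u c\<close> for \<open>c\<close> in the
  preceding term, which derived elements satisfy.\<close>

lemma eq_zero_if_orthogonal_lower_central_series:
  assumes nondeg: "nondegenerate_on \<omega> derived_algebra"
    and "x \<in> derived_algebra"
    and "\<And>c. c \<in> lower_central_series scale (commutator mult) (Suc n) \<Longrightarrow> \<omega> x c = 0"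
  shows "x = 0"
  using assms(2,3)
proof (induction n arbitrary: x)
  case 0
  then show ?case
    using nondeg unfolding nondegenerate_on_def orthogonal_space_def by auto
next
  case (Suc n)
  have "mult u x = 0" for u
  proof (rule Suc.IH)
    show "mult u x \<in> derived_algebra"
      using Suc.prems(1) by (rule mult_derived_in_derived)
    fix c
    assume c: "c \<in> lower_central_series scale (commutator mult) (Suc n)"
    then have "commutator mult u c = mult u c"
      using minus.lower_central_series_Suc_subset commutator_derived by blast
    moreover have "commutator mult u c \<in> lower_central_series scale (commutator mult) (Suc (Suc n))"
      using minus.bracket_in_bracket_span[OF UNIV_I c] by simp
    ultimately have "\<omega> x (mult u c) = 0"
      using Suc.prems(2) by metis
    then show "\<omega> (mult u x) c = 0"
      by (simp add: form_mult)
  qed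
  then have "\<omega> x y = 0" if "y \<in> derived_algebra" for y
    using that by (rule orthogonal_derived_if_mult_zero)
  then show ?case
    using nondeg Suc.prems(1) unfolding nondegenerate_on_def orthogonal_space_def by blast
qed

lemma nilpotent_imp_commutative:
  assumes "nondegenerate_on \<omega> derived_algebra"
    and "nilpotent_bracket scale (commutator mult)"
  shows "mult u v = mult v u"
proof -
  obtain n where n: "lower_central_series scale (commutator mult) n = {0}"
    using assms(2) unfolding nilpotent_bracket_def by blast
  have "lower_central_series scale (commutator mult) (Suc n) \<subseteq> {0}"
    unfolding lower_central_series.simps n bracket_span_def
    by (rule span_minimal)
      (auto simp: module_hom.zero[OF minus.linear_mult_right[unfolded linear_iff_module_hom]])
  then have "\<omega> x c = 0" if "c \<in> lower_central_series scale (commutator mult) (Suc n)" for x c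
    using that subspace_0[OF subspace_right_orthogonal[of x]] by auto
  then have "commutator mult u v = 0"
    using eq_zero_if_orthogonal_lower_central_series[OF assms(1)]
      minus.bracket_in_bracket_span[OF UNIV_I UNIV_I] by blast
  then show ?thesis
    by (simp add: commutator_def)
qed

text \<open>For a commutative product \<open>\<omega> (u v) w\<close> is invariant under moving the factors of the product
  across the form, and skew-symmetry then makes it equal to its negative.\<close>

lemma commutative_imp_trivial:
  assumes comm: "\<And>u v. mult u v = mult v u"
  shows "mult u v = 0"
proof (rule eq_zero_if_form_zero)
  fix w
  have "\<omega> (mult u v) w = \<omega> v (mult w u)"
    by (simp add: form_mult comm[of w u])
  also have "\<dots> = \<omega> (mult v w) u"
    by (simp add: form_mult[symmetric] comm[of v w])
  also have "\<dots> = \<omega> w (mult u v)"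
    by (simp add: form_mult comm[of u v])
  also have "\<dots> = - \<omega> (mult u v) w"
    by (rule skew_symmetric)
  finally show "\<omega> (mult u v) w = 0"
    by simp
qed

end

theorem corollary2p13:
  fixes scale :: "'k::field_char_0 \<Rightarrow> 'v::ab_group_add \<Rightarrow> 'v"
    and Basis :: "'v set"
    and mult :: "'v \<Rightarrow> 'v \<Rightarrow> 'v"
    and \<omega> :: "'v \<Rightarrow> 'v \<Rightarrow> 'k"
  assumes "pre_symplectic_left_symmetric_algebra scale Basis mult \<omega>"
    and "nondegenerate_on \<omega> (bracket_span scale (commutator mult) UNIV UNIV)"
  shows "nilpotent_bracket scale (commutator mult) \<longleftrightarrow> (\<forall>u v. mult u v = 0)"
proof -
  interpret pre_symplectic_left_symmetric_algebra scale Basis mult \<omega>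
    by (rule assms(1))
  show ?thesis
  proof
    assume "nilpotent_bracket scale (commutator mult)"
    then show "\<forall>u v. mult u v = 0"
      using nilpotent_imp_commutative[OF assms(2)] commutative_imp_trivial by blast
  next
    assume "\<forall>u v. mult u v = 0"
    then show "nilpotent_bracket scale (commutator mult)"
      by (intro minus.trivial_bracket_nilpotent) (simp add: commutator_def)
  qed
qed

end
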